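(* Let $X$ be a (uniformly discrete) bounded geometry quasi-geodesic metric space and let $f$ be a control function. The following conditions are equivalent: (A) there exists a constant $C>0$ such that $\#A\le C\sum_{x\in\partial A}f(|x|)$ for every finite set $A\subseteq X$; (B) $[X]=0$ in $H_0^f(X)$.
   Context: Spaces: $X$ is uniformly discrete (there is $C>0$ with $d(x,y)\ge C$ for distinct $x,y$), has bounded geometry (for every $r>0$ there is $N_r$ with $\#B(x,r)\le N_r$ for all $x\in X$), and is quasi-geodesic (for all $x,y\in X$ there is a sequence $x=x_0,x_1,\dots,x_n=y$ with $d(x_i,x_{i+1})\le1$ and $n\le d(x,y)$). Fix a base point $e\in X$. For $\overline{x}=(x_0,\dots,x_n)\in X^{n+1}$ put $|\overline{x}|=\max_i d(x_i,e)$, and for tuples $d(\overline{x},\overline{y})=\max_i d(x_i,y_i)$. Boundary: $\partial A=\{g\in X: d(g,A)=1 \text{ or } d(g,X\setminus A)=1\}$. A control function is a non-decreasing $f:[0,\infty)\to[0,\infty)$ with $f(0)=1$ such that for every $K>0$ there is $L>0$ with $f(t+K)\le Lf(t)$ and $f(Kt)\le Lf(t)$ for all $t>0$. Homology: $C_n^f(X)$ is the real vector space of functions $c:X^{n+1}\to\mathbb{R}$ (also written as formal sums $\sum c_{\overline{x}}\,\overline{x}$ of simplices) that are alternating (a permutation of the vertices multiplies the value by its sign), have finite propagation (there is $R$ with $c_{\overline{x}}=0$ whenever $d(\overline{x},\Delta_{n+1})\ge R$, where $\Delta_{n+1}\subset X^{n+1}$ is the diagonal), and satisfy $|c_{\overline{x}}|\le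 K_cf(|\overline{x}|)$ for a constant $K_c$ depending on $c$. The differential is the linear extension of $\partial[x_0,\dots,x_n]=\sum_i(-1)^i[x_0,\dots,\hat{x_i},\dots,x_n]$ (each simplex counted once up to reordering of its vertices); on functions, $(\partial c)(y_0,\dots,y_{n-1})=\sum_{z}c(z,y_0,\dots,y_{n-1})$, in particular $\partial\psi(x)=\sum_y\psi(y,x)$ for a $1$-chain $\psi$. $H_*^f(X)$ is the homology of this complex, and $[X]\in H_0^f(X)$ is the class of $\sum_{x\in X}[x]$ (the constant function $1$). *)

theory Defs
  imports "HOL-Analysis.Analysis" "HOL-Algebra.Coset" "HOL-Combinatorics.Permutations"
begin

section \<open>Metric spaces\<close>

definition bounded_geometry :: "'a::metric_space set \<Rightarrow> bool" where
  "bounded_geometry X \<longleftrightarrow>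
     (\<forall>r>0. \<exists>N::nat. \<forall>x\<in>X. finite (cball x r \<inter> X) \<and> card (cball x r \<inter> X) \<le> N)"

definition quasi_geodesic :: "'a::metric_space set \<Rightarrow> bool" where
  "quasi_geodesic X \<longleftrightarrow>
     (\<forall>x\<in>X. \<forall>y\<in>X. \<exists>(p :: nat \<Rightarrow> 'a) (n :: nat).
        (\<forall>i\<le>n. p i \<in> X) \<and> p 0 = x \<and> p n = y \<and>
        (\<forall>i<n. dist (p i) (p (Suc i)) \<le> 1) \<and> real n \<le> dist x y)"

text \<open>The space is the whole type. The distance to the empty set, conventionally infinite,
  is \<open>0\<close> for \<open>infdist\<close>; either way it is not \<open>1\<close>.\<close>

definition metric_boundary :: "'a::metric_space set \<Rightarrow> 'a set" where
  "metric_boundary A = {g. infdist g A = 1 \<or> infdist g (- A) = 1}"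

text \<open>Only the values on \<open>[0, \<infinity>)\<close> matter.\<close>

definition control_function :: "(real \<Rightarrow> real) \<Rightarrow> bool" where
  "control_function f \<longleftrightarrow>
     mono_on {0..} f \<and> (\<forall>t\<ge>0. 0 \<le> f t) \<and> f 0 = 1 \<and>
     (\<forall>K>0. \<exists>L>0. \<forall>t>0. f (t + K) \<le> L * f t \<and> f (K * t) \<le> L * f t)"

section \<open>Controlled coarse chains\<close>

text \<open>An \<open>(n+1)\<close>-tuple of points is a list of length \<open>n + 1\<close>. A function on
  \<open>(n+1)\<close>-tuples is a function on all lists that vanishes on lists of any other length.\<close>

definition simplex_norm :: "'a::metric_space \<Rightarrow> 'a list \<Rightarrow> real" where
  "simplex_norm e xs = Max ((\<lambda>x. dist x e) ` set xs)"

definition tuple_dist :: "'a::metric_space list \<Rightarrow> 'a list \<Rightarrow> real" where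
  "tuple_dist xs ys = Max ((\<lambda>i. dist (xs ! i) (ys ! i)) ` {..<length xs})"

definition dist_diagonal :: "'a::metric_space list \<Rightarrow> real" where
  "dist_diagonal xs = (INF z. tuple_dist xs (replicate (length xs) z))"

definition alternating :: "nat \<Rightarrow> ('a list \<Rightarrow> real) \<Rightarrow> bool" where
  "alternating n c \<longleftrightarrow>
     (\<forall>xs p. length xs = Suc n \<longrightarrow> p permutes {..<Suc n} \<longrightarrow>
        c (permute_list p xs) = of_int (sign p) * c xs)"

definition finite_propagation :: "nat \<Rightarrow> ('a::metric_space list \<Rightarrow> real) \<Rightarrow> bool" where
  "finite_propagation n c \<longleftrightarrow>
     (\<exists>R. \<forall>xs. length xs = Suc n \<longrightarrow> dist_diagonal xs \<ge> R \<longrightarrow> c xs = 0)"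

definition controlled ::
    "'a::metric_space \<Rightarrow> (real \<Rightarrow> real) \<Rightarrow> nat \<Rightarrow> ('a list \<Rightarrow> real) \<Rightarrow> bool" where
  "controlled e f n c \<longleftrightarrow>
     (\<exists>K. \<forall>xs. length xs = Suc n \<longrightarrow> \<bar>c xs\<bar> \<le> K * f (simplex_norm e xs))"

definition chains ::
    "'a::metric_space \<Rightarrow> (real \<Rightarrow> real) \<Rightarrow> nat \<Rightarrow> ('a list \<Rightarrow> real) set" where
  "chains e f n = {c. (\<forall>xs. length xs \<noteq> Suc n \<longrightarrow> c xs = 0) \<and>
     alternating n c \<and> finite_propagation n c \<and> controlled e f n c}"

text \<open>The differential from degree \<open>n\<close> to degree \<open>n - 1\<close>; there are no chains in negative
  degree, so it vanishes for \<open>n = 0\<close>. For chains on a space of bounded geometry only finitely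
  many summands are nonzero.\<close>

definition boundary_map :: "nat \<Rightarrow> ('a list \<Rightarrow> real) \<Rightarrow> 'a list \<Rightarrow> real" where
  "boundary_map n c ys =
     (if 0 < n \<and> length ys = n then \<Sum>z | c (z # ys) \<noteq> 0. c (z # ys) else 0)"

definition cycles ::
    "'a::metric_space \<Rightarrow> (real \<Rightarrow> real) \<Rightarrow> nat \<Rightarrow> ('a list \<Rightarrow> real) set" where
  "cycles e f n = {c \<in> chains e f n. boundary_map n c = (\<lambda>_. 0)}"

definition boundaries ::
    "'a::metric_space \<Rightarrow> (real \<Rightarrow> real) \<Rightarrow> nat \<Rightarrow> ('a list \<Rightarrow> real) set" where
  "boundaries e f n = boundary_map (Suc n) ` chains e f (Suc n)"

text \<open>Homology is recorded as the additive group underlying the real vector space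
  of cycles modulo boundaries; this determines when a class is zero.\<close>

definition cycle_group ::
    "'a::metric_space \<Rightarrow> (real \<Rightarrow> real) \<Rightarrow> nat \<Rightarrow> ('a list \<Rightarrow> real) monoid" where
  "cycle_group e f n =
     \<lparr>carrier = cycles e f n, monoid.mult = (\<lambda>a b xs. a xs + b xs), one = (\<lambda>_. 0)\<rparr>"

definition homology_group ::
    "'a::metric_space \<Rightarrow> (real \<Rightarrow> real) \<Rightarrow> nat \<Rightarrow> ('a list \<Rightarrow> real) set monoid" where
  "homology_group e f n = cycle_group e f n Mod boundaries e f n"

definition homology_class ::
    "'a::metric_space \<Rightarrow> (real \<Rightarrow> real) \<Rightarrow> nat \<Rightarrow> ('a list \<Rightarrow> real) \<Rightarrow> ('a list \<Rightarrow> real) set" where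
  "homology_class e f n c = boundaries e f n #>\<^bsub>cycle_group e f n\<^esub> c"

definition fundamental_class ::
    "'a::metric_space \<Rightarrow> (real \<Rightarrow> real) \<Rightarrow> ('a list \<Rightarrow> real) set" where
  "fundamental_class e f = homology_class e f 0 (\<lambda>xs. if length xs = 1 then 1 else 0)"

end

theory Submission
  imports Defs
begin

text \<open>A quasi-geodesic space is the vertex set of a graph with its path metric, and \<open>(B)\<close> asks for
  an antisymmetric flow \<open>\<psi>\<close> with net inflow \<open>1\<close> at every vertex and \<open>\<bar>\<psi>\<bar>\<close> bounded by \<open>f\<close>. Summing
  the inflow over a finite set \<open>A\<close> leaves only the pairs that cross from \<open>A\<close> to its complement;
  geodesics between such pairs meet \<open>\<partial>A\<close>, which gives \<open>(A)\<close>. Conversely, \<open>(A)\<close> is the cut condition for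
  capacities comparable to \<open>f\<close>. Among the flows within capacity, minimise the sum of the squares of the
  deficits \<open>u = 1 - inflow\<close> over a finite set: changing a single edge shows that an edge across
  which \<open>u\<close> drops is saturated, so summing the inflow over \<open>{u > 0}\<close> contradicts the cut condition,
  and summing it over \<open>{u < 0}\<close> contradicts the sign of the demand. Compactness of the product of the
  capacity intervals then gives a flow for all vertices at once.\<close>

section \<open>Flows on locally finite graphs\<close>

text \<open>Tychonoff: the box is a product of compact intervals, and the topology on functions is
  the product topology.\<close>

lemma compact_box:
  fixes c :: "'b \<Rightarrow> real"
  shows "compact {\<phi>. \<forall>p. 0 \<le> \<phi> p \<and> \<phi> p \<le> c p}"
proof -
  have "{\<phi>. \<forall>p. 0 \<le> \<phi> p \<and> \<phi> p \<le> c p} = (\<Pi>\<^sub>E p\<in>UNIV. {0..c p})"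
    by (auto simp: PiE_def)
  moreover have "compactin euclidean (\<Pi>\<^sub>E p\<in>UNIV. {0..c p})"
    unfolding euclidean_product_topology[symmetric] compactin_PiE by simp
  ultimately show ?thesis by simp
qed

text \<open>\<open>N x\<close> is the set of neighbours of \<open>x\<close>. Loops are allowed: the
  neighbourhoods are closed balls in one application and unit spheres in the other.\<close>

locale locally_finite_graph =
  fixes N :: "'a \<Rightarrow> 'a set"
  assumes fin: "\<And>x. finite (N x)" and sym: "\<And>x y. y \<in> N x \<Longrightarrow> x \<in> N y"
begin

text \<open>The two directions of an edge carry separate amounts, so that capacity constraints form
  a product of intervals. The antisymmetric flow is the difference of the two.\<close>

definition net_inflow :: "('a \<times> 'a \<Rightarrow> real) \<Rightarrow> 'a \<Rightarrow> real" where
  "net_inflow \<phi> x = (\<Sum>y\<in>N x. \<phi> (y, x) - \<phi> (x, y))"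

lemma net_inflow_fun_upd:
  assumes yx: "y \<in> N x" and ne: "x \<noteq> y"
  shows "net_inflow (\<phi>((y, x) := \<phi> (y, x) + t)) z =
    net_inflow \<phi> z + (if z = x then t else 0) - (if z = y then t else 0)"
proof -
  have "net_inflow (\<phi>((y, x) := \<phi> (y, x) + t)) z =
     (\<Sum>w\<in>N z. (\<phi> (w, z) - \<phi> (z, w)) + (if w = y then if z = x then t else 0 else 0)
                - (if w = x then if z = y then t else 0 else 0))"
    unfolding net_inflow_def by (intro sum.cong refl) auto
  also have "\<dots> = net_inflow \<phi> z + (if y \<in> N z then if z = x then t else 0 else 0)
      - (if x \<in> N z then if z = y then t else 0 else 0)"
    unfolding net_inflow_def sum.distrib sum_subtractf using fin[of z] by (simp add: sum.delta)
  also have "\<dots> = net_inflow \<phi> z + (if z = x then t else 0) - (if z = y then t else 0)"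
    using yx sym[OF yx] by auto
  finally show ?thesis .
qed

text \<open>A discrete divergence theorem: the flow between two points of \<open>A\<close> cancels,
  and only the pairs leaving \<open>A\<close> remain.\<close>

lemma sum_antisymmetric_neighbours:
  fixes \<psi> :: "'a \<Rightarrow> 'a \<Rightarrow> real"
  assumes anti: "\<And>x y. \<psi> x y = - \<psi> y x" and "finite A"
  shows "(\<Sum>x\<in>A. \<Sum>y\<in>N x. \<psi> y x) = (\<Sum>x\<in>A. \<Sum>y\<in>N x - A. \<psi> y x)"
proof -
  let ?g = "\<lambda>x y. if y \<in> N x then \<psi> y x else 0"
  have "(\<Sum>x\<in>A. \<Sum>y\<in>A. ?g x y) = (\<Sum>x\<in>A. \<Sum>y\<in>A. ?g y x)"
    by (rule sum.swap)
  also have "\<dots> = (\<Sum>x\<in>A. \<Sum>y\<in>A. - ?g x y)"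
  proof (intro sum.cong refl)
    show "?g y x = - ?g x y" for x y using sym anti[of x y] by auto
  qed
  finally have 0: "(\<Sum>x\<in>A. \<Sum>y\<in>A. ?g x y) = 0"
    by (simp add: sum_negf)
  have "(\<Sum>y\<in>N x. \<psi> y x) = (\<Sum>y\<in>N x - A. \<psi> y x) + (\<Sum>y\<in>A. ?g x y)" for x
  proof -
    have "(\<Sum>y\<in>N x. \<psi> y x) = (\<Sum>y\<in>N x - A. \<psi> y x) + (\<Sum>y\<in>N x \<inter> A. \<psi> y x)"
      using sum.Int_Diff[OF fin, of "\<lambda>y. \<psi> y x" x A] by simp
    also have "(\<Sum>y\<in>N x \<inter> A. \<psi> y x) = (\<Sum>y\<in>A. ?g x y)"
      using sum.inter_restrict[OF \<open>finite A\<close>, of "\<lambda>y. \<psi> y x" "N x"] by (simp add: Int_commute)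
    finally show ?thesis .
  qed
  then show ?thesis using 0 by (simp add: sum.distrib)
qed

text \<open>The change lowers the deficit at \<open>x\<close> by \<open>t\<close> and raises the one
  at \<open>y\<close> by \<open>t\<close>. Since \<open>u\<close> is \<open>0\<close> outside
  \<open>F\<close>, the linear term has the same form wherever the endpoints lie; each endpoint in
  \<open>F\<close> adds one square of \<open>t\<close>.\<close>

lemma energy_fun_upd_le:
  fixes d :: "'a \<Rightarrow> real"
  assumes yx: "y \<in> N x" and ne: "x \<noteq> y" and F: "finite F"
  defines "u \<equiv> \<lambda>\<phi> z. if z \<in> F then d z - net_inflow \<phi> z else 0"
  shows "(\<Sum>z\<in>F. (u (\<phi>((y, x) := \<phi> (y, x) + t)) z)\<^sup>2)
    \<le> (\<Sum>z\<in>F. (u \<phi> z)\<^sup>2) - 2 * t * (u \<phi> x - u \<phi> y) + 2 * t\<^sup>2"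
proof -
  have "(\<Sum>z\<in>F. (u (\<phi>((y, x) := \<phi> (y, x) + t)) z)\<^sup>2) =
      (\<Sum>z\<in>F. (u \<phi> z)\<^sup>2 + (if z = x then t\<^sup>2 - 2 * t * u \<phi> x else 0)
                       + (if z = y then t\<^sup>2 + 2 * t * u \<phi> y else 0))"
  proof (intro sum.cong refl)
    fix z assume "z \<in> F"
    then show "(u (\<phi>((y, x) := \<phi> (y, x) + t)) z)\<^sup>2 =
        (u \<phi> z)\<^sup>2 + (if z = x then t\<^sup>2 - 2 * t * u \<phi> x else 0)
                 + (if z = y then t\<^sup>2 + 2 * t * u \<phi> y else 0)"
      unfolding u_def net_inflow_fun_upd[OF yx ne]
      using ne by (auto simp: power2_eq_square algebra_simps)
  qed
  also have "\<dots> = (\<Sum>z\<in>F. (u \<phi> z)\<^sup>2) + (if x \<in> F then t\<^sup>2 - 2 * t * u \<phi> x else 0)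
                       + (if y \<in> F then t\<^sup>2 + 2 * t * u \<phi> y else 0)"
    using F by (simp add: sum.distrib sum.delta)
  also have "\<dots> \<le> (\<Sum>z\<in>F. (u \<phi> z)\<^sup>2) - 2 * t * (u \<phi> x - u \<phi> y) + 2 * t\<^sup>2"
    by (auto simp: u_def algebra_simps)
  finally show ?thesis .
qed

section \<open>Feasible flows by minimisation and compactness\<close>

lemma continuous_on_net_inflow [continuous_intros]:
  "continuous_on S (\<lambda>\<phi>. net_inflow \<phi> x)"
  unfolding net_inflow_def
  by (intro continuous_intros continuous_on_subset[OF continuous_on_product_coordinates] subset_UNIV)

text \<open>Only the vertices of \<open>F\<close> have their deficit counted; all others absorb or
  supply flow freely. The minimiser of the energy over the box meets the demand on
  \<open>F\<close>.\<close>

lemma finite_demand_met: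
  fixes c :: "'a \<Rightarrow> 'a \<Rightarrow> real" and d :: "'a \<Rightarrow> real"
  assumes c: "\<And>x y. 0 \<le> c x y" and d: "\<And>x. 0 \<le> d x"
    and cut: "\<And>A. finite A \<Longrightarrow> (\<Sum>x\<in>A. d x) \<le> (\<Sum>x\<in>A. \<Sum>y\<in>N x - A. c y x)"
    and F: "finite F"
  shows "\<exists>\<phi>. (\<forall>p. 0 \<le> \<phi> p \<and> \<phi> p \<le> case_prod c p) \<and> (\<forall>x\<in>F. net_inflow \<phi> x = d x)"
proof -
  define S where "S = {\<phi>. \<forall>p. 0 \<le> \<phi> p \<and> \<phi> p \<le> case_prod c p}"
  define u where "u \<phi> z = (if z \<in> F then d z - net_inflow \<phi> z else 0)" for \<phi> z
  define E where "E \<phi> = (\<Sum>z\<in>F. (u \<phi> z)\<^sup>2)" for \<phi>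
  have E_eq: "E = (\<lambda>\<phi>. \<Sum>z\<in>F. (d z - net_inflow \<phi> z)\<^sup>2)"
    by (auto simp: E_def u_def)
  have "continuous_on S E"
    unfolding E_eq by (intro continuous_intros)
  moreover have "compact S" unfolding S_def by (rule compact_box)
  moreover have "(\<lambda>_. 0) \<in> S" using c by (auto simp: S_def)
  ultimately obtain \<phi> where \<phi>: "\<phi> \<in> S" and min: "\<And>\<phi>'. \<phi>' \<in> S \<Longrightarrow> E \<phi> \<le> E \<phi>'"
    using continuous_attains_inf[of S E] by blast
  \<comment> \<open>An admissible change cannot lower the minimal energy, so its linear gain is at
    most the quadratic error.\<close>
  have step: "t * (u \<phi> x - u \<phi> y) \<le> t\<^sup>2"
    if "y \<in> N x" "x \<noteq> y" "\<phi>((y, x) := \<phi> (y, x) + t) \<in> S" for x y t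
    using energy_fun_upd_le[OF that(1,2) F, of d \<phi> t] min[OF that(3)]
    unfolding E_def u_def by simp
  have saturated: "\<phi> (y, x) = c y x \<and> \<phi> (x, y) = 0"
    if yx: "y \<in> N x" and less: "u \<phi> y < u \<phi> x" for x y
  proof (rule ccontr)
    assume unsat: "\<not> (\<phi> (y, x) = c y x \<and> \<phi> (x, y) = 0)"
    \<comment> \<open>Half the drop: an admissible change by \<open>t\<close> with
      \<open>0 < t \<le> s\<close> would force the drop to be at most \<open>t\<close>, hence at
      most half of itself.\<close>
    define s where "s = (u \<phi> x - u \<phi> y) / 2"
    have s: "0 < s" and ne: "x \<noteq> y" using less by (auto simp: s_def)
    have range: "0 \<le> \<phi> p" "\<phi> p \<le> case_prod c p" for p using \<phi> unfolding S_def by blast+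
    have contra: False if "0 < t" "t \<le> s" "t * (u \<phi> x - u \<phi> y) \<le> t\<^sup>2" for t
    proof -
      have "u \<phi> x - u \<phi> y \<le> t" using that by (simp add: power2_eq_square)
      then show False using that s by (simp add: s_def)
    qed
    \<comment> \<open>More can be sent from \<open>y\<close> to \<open>x\<close> either by raising
      the forward amount or by lowering the opposite one.\<close>
    consider "\<phi> (y, x) < c y x" | "0 < \<phi> (x, y)"
      using unsat range[of "(y, x)"] range[of "(x, y)"] by fastforce
    then show False
    proof cases
      case 1
      let ?t = "min s (c y x - \<phi> (y, x))"
      have "\<phi>((y, x) := \<phi> (y, x) + ?t) \<in> S"
        using 1 s range by (auto simp: S_def intro!: add_nonneg_nonneg)
      then show False using contra[of ?t] step[OF yx ne] 1 s by simp
    next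
      case 2
      let ?t = "min s (\<phi> (x, y))"
      \<comment> \<open>The same variation with the endpoints exchanged and a negative
        increment.\<close>
      have "\<phi>((x, y) := \<phi> (x, y) + (- ?t)) \<in> S"
        using 2 s range[of "(x, y)"] range by (auto simp: S_def min_def)
      then have "(- ?t) * (u \<phi> y - u \<phi> x) \<le> (- ?t)\<^sup>2"
        using step[OF sym[OF yx]] ne by blast
      then have "?t * (u \<phi> x - u \<phi> y) \<le> ?t\<^sup>2" by (simp add: algebra_simps)
      then show False using contra[of ?t] 2 s by simp
    qed
  qed
  have net: "(\<Sum>x\<in>A. net_inflow \<phi> x) = (\<Sum>x\<in>A. \<Sum>y\<in>N x - A. \<phi> (y, x) - \<phi> (x, y))"
    if "finite A" for A
    unfolding net_inflow_def
    by (rule sum_antisymmetric_neighbours[OF _ that, of "\<lambda>y x. \<phi> (y, x) - \<phi> (x, y)"])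
      auto
  have no_deficit: "u \<phi> x \<le> 0" for x
  proof (rule ccontr)
    assume x: "\<not> u \<phi> x \<le> 0"
    define A where "A = {z \<in> F. 0 < u \<phi> z}"
    have A: "finite A" "x \<in> A" using F x by (auto simp: A_def u_def split: if_splits)
    have out: "u \<phi> y \<le> 0" if "y \<notin> A" for y using that by (auto simp: A_def u_def)
    \<comment> \<open>\<open>u\<close> is positive on \<open>A\<close> and nonpositive outside, so
      every edge entering \<open>A\<close> is saturated and the net inflow is the whole capacity of
      the cut.\<close>
    have "(\<Sum>x\<in>A. \<Sum>y\<in>N x - A. c y x) = (\<Sum>x\<in>A. \<Sum>y\<in>N x - A. \<phi> (y, x) - \<phi> (x, y))"
    proof (intro sum.cong refl)
      fix x y assume "x \<in> A" "y \<in> N x - A"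
      then show "c y x = \<phi> (y, x) - \<phi> (x, y)"
        using saturated[of y x] out[of y] by (force simp: A_def)
    qed
    also have "\<dots> = (\<Sum>x\<in>A. net_inflow \<phi> x)" using net A by simp
    also have "\<dots> < (\<Sum>x\<in>A. d x)"
      using A by (intro sum_strict_mono) (auto simp: A_def u_def)
    finally show False using cut[OF A(1)] by simp
  qed
  have no_surplus: "0 \<le> u \<phi> x" for x
  proof (rule ccontr)
    assume x: "\<not> 0 \<le> u \<phi> x"
    define A where "A = {z \<in> F. u \<phi> z < 0}"
    have A: "finite A" "x \<in> A" using F x by (auto simp: A_def u_def split: if_splits)
    have out: "0 \<le> u \<phi> y" if "y \<notin> A" for y using that by (auto simp: A_def u_def)
    have "0 \<le> (\<Sum>x\<in>A. d x)" using d by (simp add: sum_nonneg)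
    also have "\<dots> < (\<Sum>x\<in>A. net_inflow \<phi> x)"
      using A by (intro sum_strict_mono) (auto simp: A_def u_def)
    also have "\<dots> = (\<Sum>x\<in>A. \<Sum>y\<in>N x - A. \<phi> (y, x) - \<phi> (x, y))" using net A by simp
    also have "\<dots> \<le> 0"
    proof (intro sum_nonpos)
      fix x y assume "x \<in> A" "y \<in> N x - A"
      \<comment> \<open>Now \<open>u\<close> is larger outside \<open>A\<close>, so saturation with
        the endpoints exchanged stops all flow into \<open>A\<close>.\<close>
      then have "\<phi> (y, x) = 0"
        using saturated[of x y] sym[of y x] out[of y] by (force simp: A_def)
      then show "\<phi> (y, x) - \<phi> (x, y) \<le> 0" using \<phi> by (simp add: S_def)
    qed
    finally show False by simp
  qed
  have "net_inflow \<phi> x = d x" if "x \<in> F" for x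
    using no_deficit[of x] no_surplus[of x] that by (simp add: u_def)
  then show ?thesis using \<phi> by (auto simp: S_def)
qed

text \<open>Meeting the demand at one vertex is a closed condition on the compact box, and any
  finitely many such conditions are compatible.\<close>

lemma demand_met:
  fixes c :: "'a \<Rightarrow> 'a \<Rightarrow> real" and d :: "'a \<Rightarrow> real"
  assumes c: "\<And>x y. 0 \<le> c x y" and d: "\<And>x. 0 \<le> d x"
    and cut: "\<And>A. finite A \<Longrightarrow> (\<Sum>x\<in>A. d x) \<le> (\<Sum>x\<in>A. \<Sum>y\<in>N x - A. c y x)"
  obtains \<psi> where "\<And>x y. \<psi> y x = - \<psi> x y" "\<And>x y. \<psi> x y \<le> c x y"
    "\<And>x y. y \<notin> N x \<Longrightarrow> \<psi> y x = 0" "\<And>x. (\<Sum>y\<in>N x. \<psi> y x) = d x"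
proof -
  define S where "S = {\<phi>. \<forall>p. 0 \<le> \<phi> p \<and> \<phi> p \<le> case_prod c p}"
  have "S \<inter> (\<Inter>x\<in>UNIV. {\<phi>. net_inflow \<phi> x = d x}) \<noteq> {}"
  proof (rule compact_imp_fip_image)
    show "compact S" unfolding S_def by (rule compact_box)
    show "closed {\<phi>. net_inflow \<phi> x = d x}" for x
      by (intro closed_Collect_eq continuous_intros)
    show "S \<inter> (\<Inter>x\<in>F. {\<phi>. net_inflow \<phi> x = d x}) \<noteq> {}" if F: "finite F" for F
    proof -
      obtain \<phi> where "\<forall>p. 0 \<le> \<phi> p \<and> \<phi> p \<le> case_prod c p" "\<forall>x\<in>F. net_inflow \<phi> x = d x"
        using finite_demand_met[OF c d cut F] by blast
      then show ?thesis unfolding S_def by blast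
    qed
  qed
  then obtain \<phi> where \<phi>: "\<phi> \<in> S" and net: "\<And>x. net_inflow \<phi> x = d x" by auto
  \<comment> \<open>Off the edges \<open>\<phi>\<close> is arbitrary within the box and does not
    enter \<open>net_inflow\<close>, so it is cut off there.\<close>
  define \<psi> where "\<psi> y x = (if y \<in> N x then \<phi> (y, x) - \<phi> (x, y) else 0)" for y x
  show thesis
  proof
    show "\<psi> y x = - \<psi> x y" for x y using sym by (auto simp: \<psi>_def)
    show "\<psi> x y \<le> c x y" for x y
    proof -
      have "\<phi> (x, y) \<le> c x y" "0 \<le> \<phi> (y, x)" using \<phi> by (auto simp: S_def)
      then show ?thesis using c[of x y] by (auto simp: \<psi>_def)
    qed
    show "y \<notin> N x \<Longrightarrow> \<psi> y x = 0" for x y by (simp add: \<psi>_def)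
    show "(\<Sum>y\<in>N x. \<psi> y x) = d x" for x
      using net[of x] by (simp add: net_inflow_def \<psi>_def)
  qed
qed

end

section \<open>Vanishing of homology classes\<close>

text \<open>Some \<open>z\<close> has all vertices of \<open>xs\<close> closer than
  \<open>R\<close>; the triangle inequality through \<open>z\<close> gives
  \<open>2 * R\<close>.\<close>

lemma dist_le_propagation:
  assumes R: "dist_diagonal xs < R" and xy: "x \<in> set xs" "y \<in> set xs"
  shows "dist x y < 2 * R"
proof -
  have xs: "xs \<noteq> []" using xy by auto
  let ?t = "\<lambda>z. tuple_dist xs (replicate (length xs) z)"
  have t: "dist w z \<le> ?t z" if "w \<in> set xs" for w z
    using that by (auto simp: tuple_dist_def in_set_conv_nth intro!: Max_ge)
  \<comment> \<open>The infimum of reals can be compared with \<open>R\<close> only once it is known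
    to be bounded below.\<close>
  have "bdd_below (range ?t)"
    using t[of "hd xs"] xs by (intro bdd_belowI2[of _ 0]) (auto intro: order_trans[OF zero_le_dist])
  then obtain z where z: "?t z < R"
    using R xs unfolding dist_diagonal_def by (subst (asm) cINF_less_iff) auto
  have "dist x y \<le> dist x z + dist y z" by (rule dist_triangle2)
  then show ?thesis using t[OF xy(1), of z] t[OF xy(2), of z] z by linarith
qed

text \<open>Finite propagation confines \<open>z\<close> to a ball about any vertex of
  \<open>ys\<close>. This makes the sum in \<open>boundary_map\<close> genuine: over an infinite set
  it would be \<open>0\<close> by default.\<close>

lemma finite_coboundary_support:
  fixes c :: "'a::metric_space list \<Rightarrow> real"
  assumes bg: "bounded_geometry (UNIV :: 'a set)" and c: "c \<in> chains e f (Suc n)"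
  shows "finite {z. c (z # ys) \<noteq> 0}"
proof (cases "length ys = Suc n")
  case True
  then obtain y where y: "y \<in> set ys" by (cases ys) auto
  from c obtain R where R: "\<And>xs. length xs = Suc (Suc n) \<Longrightarrow> dist_diagonal xs \<ge> R \<Longrightarrow> c xs = 0"
    unfolding chains_def finite_propagation_def by blast
  \<comment> \<open>\<open>R\<close> may be negative, whereas bounded geometry speaks of positive
    radii.\<close>
  have "z \<in> cball y (max 1 (2 * R))" if "c (z # ys) \<noteq> 0" for z
    using R[of "z # ys"] that True y dist_le_propagation[of "z # ys" R y z] by fastforce
  then have "{z. c (z # ys) \<noteq> 0} \<subseteq> cball y (max 1 (2 * R))" by blast
  moreover have "finite (cball y (max 1 (2 * R)))"
    using bg unfolding bounded_geometry_def by (auto dest!: spec[of _ "max 1 (2 * R)"])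
  ultimately show ?thesis by (rule finite_subset)
qed (use c in \<open>simp add: chains_def\<close>)

section \<open>Linearity of chains and of the differential\<close>

lemma chains_add:
  assumes "a \<in> chains e f n" "b \<in> chains e f n"
  shows "(\<lambda>xs. a xs + b xs) \<in> chains e f n"
proof -
  obtain R S where R: "\<And>xs. length xs = Suc n \<Longrightarrow> dist_diagonal xs \<ge> R \<Longrightarrow> a xs = 0"
    and S: "\<And>xs. length xs = Suc n \<Longrightarrow> dist_diagonal xs \<ge> S \<Longrightarrow> b xs = 0"
    using assms unfolding chains_def finite_propagation_def by blast
  have fp: "finite_propagation n (\<lambda>xs. a xs + b xs)"
    unfolding finite_propagation_def using R S by (intro exI[of _ "max R S"]) auto
  obtain K L where K: "\<And>xs. length xs = Suc n \<Longrightarrow> \<bar>a xs\<bar> \<le> K * f (simplex_norm e xs)"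
    and L: "\<And>xs. length xs = Suc n \<Longrightarrow> \<bar>b xs\<bar> \<le> L * f (simplex_norm e xs)"
    using assms unfolding chains_def controlled_def by blast
  have "controlled e f n (\<lambda>xs. a xs + b xs)"
    unfolding controlled_def
  proof (intro exI allI impI)
    fix xs :: "'a list" assume "length xs = Suc n"
    then show "\<bar>a xs + b xs\<bar> \<le> (K + L) * f (simplex_norm e xs)"
      using K[of xs] L[of xs] by (simp add: distrib_right)
  qed
  then show ?thesis
    using assms fp by (simp add: chains_def alternating_def algebra_simps)
qed

lemma chains_minus:
  assumes "a \<in> chains e f n"
  shows "(\<lambda>xs. - a xs) \<in> chains e f n"
  using assms by (simp add: chains_def alternating_def finite_propagation_def controlled_def)

lemma chains_zero: "(\<lambda>_. 0) \<in> chains e f n"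
  by (auto simp: chains_def alternating_def finite_propagation_def controlled_def intro: exI[of _ 0])

text \<open>The three sums run over different supports, so each is extended to the finite union of
  the supports of \<open>a\<close> and \<open>b\<close>.\<close>

lemma boundary_map_add:
  fixes a :: "'a::metric_space list \<Rightarrow> real"
  assumes bg: "bounded_geometry (UNIV :: 'a set)"
    and a: "a \<in> chains e f (Suc n)" and b: "b \<in> chains e f (Suc n)"
  shows "boundary_map (Suc n) (\<lambda>xs. a xs + b xs) =
    (\<lambda>ys. boundary_map (Suc n) a ys + boundary_map (Suc n) b ys)"
proof
  fix ys
  let ?S = "{z. a (z # ys) \<noteq> 0} \<union> {z. b (z # ys) \<noteq> 0}"
  have fin: "finite ?S" using finite_coboundary_support[OF bg] a b by blast
  have "(\<Sum>z | g z \<noteq> 0. g z) = (\<Sum>z\<in>?S. g z)" if "{z. g z \<noteq> 0} \<subseteq> ?S" for g :: "'a \<Rightarrow> real"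
    using that fin by (intro sum.mono_neutral_left) auto
  then have "(\<Sum>z | g z \<noteq> 0. g z) = (\<Sum>z\<in>?S. g z)"
    if "\<forall>z. a (z # ys) = 0 \<longrightarrow> b (z # ys) = 0 \<longrightarrow> g z = 0" for g :: "'a \<Rightarrow> real"
    using that by blast
  from this[of "\<lambda>z. a (z # ys)"] this[of "\<lambda>z. b (z # ys)"] this[of "\<lambda>z. a (z # ys) + b (z # ys)"]
  show "boundary_map (Suc n) (\<lambda>xs. a xs + b xs) ys =
      boundary_map (Suc n) a ys + boundary_map (Suc n) b ys"
    by (simp add: boundary_map_def flip: sum.distrib)
qed

lemma boundary_map_minus: "boundary_map n (\<lambda>xs. - a xs) = (\<lambda>ys. - boundary_map n a ys)"
  by (auto simp: boundary_map_def sum_negf)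

text \<open>The identity of the quotient is the set of boundaries itself. As this set contains
  \<open>0\<close> and is closed under sums and negatives, its translate by \<open>c\<close> equals
  it exactly when it contains \<open>c\<close>.\<close>

lemma homology_class_eq_one_iff:
  fixes e :: "'a::metric_space"
  assumes bg: "bounded_geometry (UNIV :: 'a set)"
  shows "homology_class e f n c = \<one>\<^bsub>homology_group e f n\<^esub> \<longleftrightarrow> c \<in> boundaries e f n"
proof -
  let ?B = "boundaries e f n"
  have add: "(\<lambda>xs. a xs + b xs) \<in> ?B" if ab: "a \<in> ?B" "b \<in> ?B" for a b
  proof -
    from ab obtain a' b' where "a' \<in> chains e f (Suc n)" "b' \<in> chains e f (Suc n)"
      "a = boundary_map (Suc n) a'" "b = boundary_map (Suc n) b'"
      unfolding boundaries_def by blast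
    then show ?thesis
      unfolding boundaries_def
      by (intro image_eqI[of _ _ "\<lambda>xs. a' xs + b' xs"])
        (simp_all only: boundary_map_add[OF bg] chains_add)
  qed
  have minus: "(\<lambda>xs. - a xs) \<in> ?B" if "a \<in> ?B" for a
  proof -
    from that obtain a' where "a' \<in> chains e f (Suc n)" "a = boundary_map (Suc n) a'"
      unfolding boundaries_def by blast
    then show ?thesis
      unfolding boundaries_def
      by (intro image_eqI[of _ _ "\<lambda>xs. - a' xs"]) (simp_all only: boundary_map_minus chains_minus)
  qed
  have "boundary_map (Suc n) (\<lambda>_ :: 'a list. 0) = (\<lambda>_. 0)"
    by (simp add: boundary_map_def fun_eq_iff)
  then have zero: "(\<lambda>_. 0) \<in> ?B"
    using imageI[OF chains_zero, of "boundary_map (Suc n)" e f "Suc n"] by (simp add: boundaries_def)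
  have cls: "homology_class e f n c = (\<lambda>h xs. h xs + c xs) ` ?B"
    by (auto simp: homology_class_def r_coset_def cycle_group_def)
  have one: "\<one>\<^bsub>homology_group e f n\<^esub> = ?B"
    by (simp add: homology_group_def FactGroup_def)
  show ?thesis
    unfolding cls one
  proof
    assume eq: "(\<lambda>h xs. h xs + c xs) ` ?B = ?B"
    have "(\<lambda>xs. 0 + c xs) \<in> (\<lambda>h xs. h xs + c xs) ` ?B"
      by (rule imageI[OF zero])
    then show "c \<in> ?B" unfolding eq by simp
  next
    assume c: "c \<in> ?B"
    show "(\<lambda>h xs. h xs + c xs) ` ?B = ?B"
    proof (rule equalityI; rule subsetI)
      fix h assume "h \<in> ?B"
      then have "(\<lambda>xs. h xs + - c xs) \<in> ?B" using add minus[OF c] by blast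
      then have "(\<lambda>xs. (h xs + - c xs) + c xs) \<in> (\<lambda>h xs. h xs + c xs) ` ?B"
        by (rule imageI)
      then show "h \<in> (\<lambda>h xs. h xs + c xs) ` ?B" by simp
    next
      fix h assume "h \<in> (\<lambda>h xs. h xs + c xs) ` ?B"
      then show "h \<in> ?B" using add[OF _ c] by (elim imageE) simp
    qed
  qed
qed

lemma alternating_swap:
  assumes "alternating 1 c"
  shows "c [y, x] = - c [x, y]"
proof -
  have "Transposition.transpose 0 (Suc 0) permutes {..<Suc 1}"
    by (intro permutes_swap_id) auto
  then have "c (permute_list (Transposition.transpose 0 (Suc 0)) [x, y]) =
      of_int (sign (Transposition.transpose 0 (Suc 0))) * c [x, y]"
    using assms unfolding alternating_def by auto
  then show ?thesis by (simp add: permute_list_def sign_swap_id transpose_def)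
qed

text \<open>Two indices admit only the identity and one transposition, so antisymmetry
  suffices.\<close>

lemma alternating_pairI:
  assumes "\<And>x y. \<psi> y x = - \<psi> x y"
  shows "alternating 1 (\<lambda>xs. if length xs = 2 then \<psi> (xs ! 0) (xs ! 1) else 0)"
  unfolding alternating_def
proof (intro allI impI)
  fix xs :: "'a list" and p assume xs: "length xs = Suc 1" and p: "p permutes {..<Suc 1}"
  have "{..<Suc 1} = {0, Suc 0}" by auto
  then have "p = id \<or> p = Transposition.transpose 0 (Suc 0)"
    using p permutes_doubleton_iff by metis
  then show "(if length (permute_list p xs) = 2 then \<psi> (permute_list p xs ! 0) (permute_list p xs ! 1) else 0)
      = of_int (sign p) * (if length xs = 2 then \<psi> (xs ! 0) (xs ! 1) else 0)"
    using xs assms[of "xs ! 1" "xs ! 0"]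
    by (auto simp: permute_list_def sign_swap_id transpose_def)
qed

section \<open>Isoperimetry in quasi-geodesic spaces\<close>

lemma dist_path_le:
  fixes p :: "nat \<Rightarrow> 'a::metric_space"
  assumes "\<And>i. i < n \<Longrightarrow> dist (p i) (p (Suc i)) \<le> 1" and "i \<le> j" and "j \<le> n"
  shows "dist (p i) (p j) \<le> real j - real i"
  using assms(2,3)
proof (induction j rule: dec_induct)
  case (step m)
  then show ?case
    using assms(1)[of m] dist_triangle[of "p i" "p (Suc m)" "p m"] by simp
qed simp

locale quasi_geodesic_space =
  fixes space_type :: "'a::metric_space itself"
  assumes quasi_geodesic: "quasi_geodesic (UNIV :: 'a set)"
    and bounded_geometry: "bounded_geometry (UNIV :: 'a set)"
begin

text \<open>The triangle inequality bounds the distance by the number of steps, and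
  quasi-geodesicity gives the reverse bound. Hence distances are integers and the path is a
  geodesic.\<close>

lemma unit_step_path:
  fixes x y :: 'a
  obtains p :: "nat \<Rightarrow> 'a" and n where "p 0 = x" "p n = y"
    "\<And>i. i < n \<Longrightarrow> dist (p i) (p (Suc i)) \<le> 1" "dist x y = real n"
proof -
  obtain p :: "nat \<Rightarrow> 'a" and n where p: "p 0 = x" "p n = y"
    "\<And>i. i < n \<Longrightarrow> dist (p i) (p (Suc i)) \<le> 1" "real n \<le> dist x y"
    using quasi_geodesic unfolding quasi_geodesic_def by (metis UNIV_I)
  then have "dist x y \<le> real n" using dist_path_le[of n p 0 n] by simp
  then show ?thesis using that[OF p(1-3)] p(4) by simp
qed

lemma one_le_dist: "x \<noteq> y \<Longrightarrow> 1 \<le> dist x y" for x y :: 'a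
  using unit_step_path[of x y] by (metis One_nat_def Suc_leI dist_pos_lt of_nat_0_less_iff of_nat_1 of_nat_le_iff)

lemma dist_eq_one_if_less_two: "1 \<le> dist x y \<Longrightarrow> dist x y < 2 \<Longrightarrow> dist x y = 1" for x y :: 'a
  by (rule unit_step_path[of x y]) auto

lemma finite_cball: "finite (cball x r)" for x :: 'a
proof -
  have "finite (cball x (max 1 r))"
    using bounded_geometry unfolding bounded_geometry_def by (auto dest!: spec[of _ "max 1 r"])
  then show ?thesis by (rule rev_finite_subset) auto
qed

text \<open>Because distances are integers, an infimum equal to \<open>1\<close> is attained: any
  point closer than \<open>2\<close> will do.\<close>

lemma infdist_eq_one_iff: "infdist x A = 1 \<longleftrightarrow> x \<notin> A \<and> (\<exists>z\<in>A. dist x z = 1)" for x :: 'a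
proof
  assume 1: "infdist x A = 1"
  \<comment> \<open>The default value of \<open>infdist\<close> at the empty set is
    \<open>0\<close>, not \<open>1\<close>.\<close>
  then have A: "A \<noteq> {}" by (auto simp: infdist_def)
  have "(INF z\<in>A. dist x z) < 2" using 1 A by (simp add: infdist_def)
  then obtain z where z: "z \<in> A" "dist x z < 2"
    using A by (subst (asm) cINF_less_iff) auto
  moreover have "1 \<le> dist x z" using infdist_le[OF z(1), of x] 1 by simp
  moreover have "x \<notin> A" using infdist_le[of x A x] 1 by auto
  ultimately show "x \<notin> A \<and> (\<exists>z\<in>A. dist x z = 1)"
    using dist_eq_one_if_less_two by blast
next
  assume x: "x \<notin> A \<and> (\<exists>z\<in>A. dist x z = 1)"
  then obtain z where z: "z \<in> A" "dist x z = 1" by blast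
  then have "A \<noteq> {}" by blast
  then have "1 \<le> infdist x A"
    using x unfolding infdist_notempty[OF \<open>A \<noteq> {}\<close>] by (intro cINF_greatest one_le_dist) auto
  moreover have "infdist x A \<le> 1" using infdist_le[OF z(1), of x] z(2) by simp
  ultimately show "infdist x A = 1" by simp
qed

lemma metric_boundary_iff:
  fixes g :: 'a
  shows "g \<in> metric_boundary A \<longleftrightarrow>
    (g \<notin> A \<and> (\<exists>z\<in>A. dist g z = 1)) \<or> (g \<in> A \<and> (\<exists>z\<in>-A. dist g z = 1))"
  by (auto simp: metric_boundary_def infdist_eq_one_iff)

lemma finite_metric_boundary: "finite A \<Longrightarrow> finite (metric_boundary A)" for A :: "'a set"
proof (rule finite_subset)
  show "metric_boundary A \<subseteq> (\<Union>a\<in>A. cball a 1)"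
    by (force simp: metric_boundary_iff dist_commute)
qed (use finite_cball in auto)

text \<open>On a geodesic from \<open>x\<close> to \<open>y\<close>, the first point outside
  \<open>A\<close> is at distance \<open>1\<close> from its predecessor in \<open>A\<close>. Points
  of a geodesic are no further from either end than the ends are from each other.\<close>

lemma path_crosses_boundary:
  fixes x y :: 'a
  assumes x: "x \<in> A" and y: "y \<notin> A"
  obtains g where "g \<in> metric_boundary A" "dist g x \<le> dist x y" "dist g y \<le> dist x y"
proof -
  obtain p n where p: "p 0 = x" "p n = y"
    "\<And>i. i < n \<Longrightarrow> dist (p i) (p (Suc i)) \<le> 1" "dist x y = real n"
    using unit_step_path[of x y] by blast
  define k where "k = (LEAST i. p i \<notin> A)"
  have k: "p k \<notin> A" "k \<le> n"
    using y p(2) LeastI[of "\<lambda>i. p i \<notin> A" n] Least_le[of "\<lambda>i. p i \<notin> A" n] by (simp_all add: k_def)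
  have "k \<noteq> 0" using k(1) p(1) x by metis
  then obtain j where j: "k = Suc j" using not0_implies_Suc by blast
  have "p j \<in> A" using not_less_Least[of j "\<lambda>i. p i \<notin> A"] j k_def by auto
  moreover have "dist (p k) (p j) = 1"
    using p(3)[of j] one_le_dist[of "p k" "p j"] j k \<open>p j \<in> A\<close>
    by (metis Suc_le_lessD dist_commute order_antisym)
  ultimately have "p k \<in> metric_boundary A"
    using k(1) by (auto simp: metric_boundary_iff)
  moreover have "dist (p k) x \<le> dist x y" "dist (p k) y \<le> dist x y"
    using dist_path_le[of n p 0 k] dist_path_le[of n p k n] p k by (simp_all add: dist_commute)
  ultimately show ?thesis by (rule that)
qed

end

section \<open>Control functions and norms of simplices with one or two vertices\<close>

lemma control_function_mono: "control_function f \<Longrightarrow> 0 \<le> s \<Longrightarrow> s \<le> t \<Longrightarrow> f s \<le> f t"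
  by (auto simp: control_function_def mono_on_def)

lemma control_function_nonneg: "control_function f \<Longrightarrow> 0 \<le> t \<Longrightarrow> 0 \<le> f t"
  by (simp add: control_function_def)

text \<open>The definition gives the bound for \<open>t > 0\<close> only; at \<open>t = 0\<close>
  the constant \<open>f D\<close> serves, since \<open>f 0 = 1\<close>.\<close>

lemma control_function_shift:
  assumes "control_function f" and "0 < D"
  obtains L where "0 < L" "\<And>t. 0 \<le> t \<Longrightarrow> f (t + D) \<le> L * f t"
proof -
  obtain L where L: "0 < L" "\<And>t. 0 < t \<Longrightarrow> f (t + D) \<le> L * f t"
    using assms unfolding control_function_def by blast
  have f: "\<And>t. 0 \<le> t \<Longrightarrow> 0 \<le> f t" "f 0 = 1"
    using assms unfolding control_function_def by auto
  have le: "f (t + D) \<le> max L (f D) * f t" if "0 \<le> t" for t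
  proof (cases "t = 0")
    case False
    then have "f (t + D) \<le> L * f t" using L that by simp
    also have "\<dots> \<le> max L (f D) * f t" using f that by (intro mult_right_mono) auto
    finally show ?thesis .
  qed (simp add: f)
  have "0 < max L (f D)" using L(1) by simp
  then show ?thesis using le by (rule that)
qed

lemma simplex_norm_singleton: "simplex_norm e [x] = dist x e"
  by (simp add: simplex_norm_def)

lemma simplex_norm_pair: "simplex_norm e [x, y] = max (dist x e) (dist y e)"
  by (simp add: simplex_norm_def)

section \<open>Isoperimetric inequalities and flows of unit inflow\<close>

context quasi_geodesic_space
begin

text \<open>Each pair crossing out of \<open>A\<close> is charged to a boundary point within
  \<open>D\<close> of both its ends. There \<open>f\<close> is comparable to its value at the pair,
  and bounded geometry limits how many pairs one point receives.\<close>

lemma isoperimetric_if_flow: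
  fixes e :: 'a and \<psi> :: "'a \<Rightarrow> 'a \<Rightarrow> real"
  assumes f: "control_function f" and D: "0 < D" and K: "0 \<le> K"
    and anti: "\<And>x y. \<psi> y x = - \<psi> x y"
    and bound: "\<And>x y. dist x y \<le> D \<Longrightarrow> \<bar>\<psi> x y\<bar> \<le> K * f (max (dist x e) (dist y e))"
    and inflow: "\<And>x. (\<Sum>y\<in>cball x D. \<psi> y x) = 1"
  shows "\<exists>C>0. \<forall>A :: 'a set. finite A \<longrightarrow> real (card A) \<le> C * (\<Sum>g\<in>metric_boundary A. f (dist g e))"
proof -
  note mono = control_function_mono[OF f] and nonneg = control_function_nonneg[OF f]
  obtain L where L: "0 < L" "\<And>t. 0 \<le> t \<Longrightarrow> f (t + D) \<le> L * f t"
    using control_function_shift[OF f D] by blast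
  have "\<exists>M::nat. \<forall>x\<in>(UNIV :: 'a set). finite (cball x D \<inter> UNIV) \<and> card (cball x D \<inter> UNIV) \<le> M"
    using bounded_geometry D unfolding bounded_geometry_def by blast
  then obtain M :: nat where M: "\<And>x :: 'a. card (cball x D) \<le> M" by auto
  interpret locally_finite_graph "\<lambda>x :: 'a. cball x D"
    by standard (auto simp: finite_cball dist_commute)
  \<comment> \<open>At most \<open>M * M\<close> pairs per boundary point, \<open>K\<close> from the
    flow bound and \<open>L\<close> from the shift by \<open>D\<close>; the summand \<open>1\<close>
    keeps \<open>C\<close> positive when \<open>K = 0\<close>.\<close>
  define C where "C = real M * real M * K * L + 1"
  have "real (card A) \<le> C * (\<Sum>g\<in>metric_boundary A. f (dist g e))" if A: "finite A" for A :: "'a set"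
  proof -
    define E where "E = (SIGMA x:A. cball x D - A)"
    have E: "finite E" unfolding E_def using A finite_cball by auto
    have "\<exists>g. g \<in> metric_boundary A \<and> dist g (fst p) \<le> D \<and> dist g (snd p) \<le> D" if "p \<in> E" for p
    proof (rule path_crosses_boundary[of "fst p" A "snd p"])
      have "dist (fst p) (snd p) \<le> D" using that by (auto simp: E_def)
      then show "\<exists>g. g \<in> metric_boundary A \<and> dist g (fst p) \<le> D \<and> dist g (snd p) \<le> D"
        if "g \<in> metric_boundary A" "dist g (fst p) \<le> dist (fst p) (snd p)"
          "dist g (snd p) \<le> dist (fst p) (snd p)" for g
        using that by (intro exI[of _ g]) auto
    qed (use that in \<open>auto simp: E_def\<close>)
    then obtain \<gamma> where "\<And>p. p \<in> E \<Longrightarrow>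
        \<gamma> p \<in> metric_boundary A \<and> dist (\<gamma> p) (fst p) \<le> D \<and> dist (\<gamma> p) (snd p) \<le> D"
      by metis
    then have \<gamma>: "\<And>x y. (x, y) \<in> E \<Longrightarrow>
        \<gamma> (x, y) \<in> metric_boundary A \<and> dist (\<gamma> (x, y)) x \<le> D \<and> dist (\<gamma> (x, y)) y \<le> D"
      by fastforce
    have "real (card A) = (\<Sum>x\<in>A. \<Sum>y\<in>cball x D. \<psi> y x)" by (simp add: inflow)
    also have "\<dots> = (\<Sum>x\<in>A. \<Sum>y\<in>cball x D - A. \<psi> y x)"
      by (rule sum_antisymmetric_neighbours[OF anti A])
    also have "\<dots> = (\<Sum>(x, y)\<in>E. \<psi> y x)"
      unfolding E_def using A finite_cball by (subst sum.Sigma) auto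
    also have "\<dots> \<le> (\<Sum>p\<in>E. K * L * f (dist (\<gamma> p) e))"
    proof (rule sum_mono, clarify)
      fix x y assume xy: "(x, y) \<in> E"
      let ?g = "\<gamma> (x, y)"
      have "max (dist y e) (dist x e) \<le> dist ?g e + D"
        using \<gamma>[OF xy] dist_triangle3[of x e ?g] dist_triangle3[of y e ?g] by auto
      then have "f (max (dist y e) (dist x e)) \<le> L * f (dist ?g e)"
        using mono[of "max (dist y e) (dist x e)" "dist ?g e + D"] L(2)[of "dist ?g e"]
        by (auto simp: le_max_iff_disj)
      moreover have "\<psi> y x \<le> K * f (max (dist y e) (dist x e))"
        using bound[of y x] xy by (auto simp: E_def dist_commute)
      ultimately show "\<psi> y x \<le> K * L * f (dist ?g e)"
        using K mult_left_mono[of "f (max (dist y e) (dist x e))" "L * f (dist ?g e)" K] by simp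
    qed
    \<comment> \<open>The crossing pairs are grouped by the boundary point to which they are
      charged.\<close>
    also have "\<dots> = (\<Sum>g\<in>metric_boundary A. \<Sum>p\<in>{p\<in>E. \<gamma> p = g}. K * L * f (dist (\<gamma> p) e))"
      using \<gamma> by (intro sum.group[symmetric] E finite_metric_boundary A) auto
    also have "\<dots> \<le> (\<Sum>g\<in>metric_boundary A. C * f (dist g e))"
    proof (rule sum_mono)
      fix g assume "g \<in> metric_boundary A"
      have "{p\<in>E. \<gamma> p = g} \<subseteq> cball g D \<times> cball g D"
        using \<gamma> by auto
      then have "card {p\<in>E. \<gamma> p = g} \<le> card (cball g D) * card (cball g D)"
        unfolding card_cartesian_product[symmetric]
        by (intro card_mono finite_cartesian_product finite_cball)
      also have "\<dots> \<le> M * M" by (intro mult_le_mono M)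
      finally have card: "real (card {p\<in>E. \<gamma> p = g}) \<le> real M * real M"
        by (metis of_nat_le_iff of_nat_mult)
      have "(\<Sum>p\<in>{p\<in>E. \<gamma> p = g}. K * L * f (dist (\<gamma> p) e))
          = real (card {p\<in>E. \<gamma> p = g}) * (K * L * f (dist g e))" by simp
      also have "\<dots> \<le> real M * real M * (K * L * f (dist g e))"
        using K L nonneg card by (intro mult_right_mono) auto
      also have "\<dots> \<le> C * f (dist g e)"
        using nonneg[of "dist g e"] by (simp add: C_def algebra_simps)
      finally show "(\<Sum>p\<in>{p\<in>E. \<gamma> p = g}. K * L * f (dist (\<gamma> p) e)) \<le> C * f (dist g e)" .
    qed
    finally show ?thesis by (simp add: sum_distrib_left)
  qed
  moreover have "0 < C" using K L by (simp add: C_def add_nonneg_pos)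
  ultimately show ?thesis by blast
qed

text \<open>With capacity \<open>C * (f (dist x e) + f (dist y e))\<close> on pairs at distance
  \<open>1\<close>, the isoperimetric inequality yields the cut condition for demand
  \<open>1\<close>: every boundary point is an end of a crossing edge.\<close>

lemma flow_if_isoperimetric:
  fixes e :: 'a
  assumes f: "\<And>t. 0 \<le> t \<Longrightarrow> 0 \<le> f t" and C: "0 < C"
    and iso: "\<And>A :: 'a set. finite A \<Longrightarrow> real (card A) \<le> C * (\<Sum>g\<in>metric_boundary A. f (dist g e))"
  obtains \<psi> :: "'a \<Rightarrow> 'a \<Rightarrow> real" where "\<And>x y. \<psi> y x = - \<psi> x y"
    "\<And>x y. \<psi> x y \<le> C * (f (dist x e) + f (dist y e))"
    "\<And>x y. dist x y \<noteq> 1 \<Longrightarrow> \<psi> y x = 0" "\<And>x. (\<Sum>y\<in>sphere x 1. \<psi> y x) = 1"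
proof -
  interpret locally_finite_graph "\<lambda>x :: 'a. sphere x 1"
    by standard (auto simp: dist_commute intro: finite_subset[OF sphere_cball finite_cball])
  let ?c = "\<lambda>x y. C * (f (dist x e) + f (dist y e))"
  have cut: "(\<Sum>x\<in>A. 1) \<le> (\<Sum>x\<in>A. \<Sum>y\<in>sphere x 1 - A. ?c y x)" if A: "finite A" for A :: "'a set"
  proof -
    let ?E = "SIGMA x:A. sphere x 1 - A"
    let ?f = "\<lambda>x. f (dist x e)"
    have E: "finite ?E" using A fin by auto
    \<comment> \<open>Boundary points inside \<open>A\<close> are first components of crossing
      edges, those outside are second components.\<close>
    have "metric_boundary A \<subseteq> fst ` ?E \<union> snd ` ?E"
    proof
      fix g assume "g \<in> metric_boundary A"
      then obtain z where "(g, z) \<in> ?E \<or> (z, g) \<in> ?E"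
        by (auto simp: metric_boundary_iff dist_commute)
      then show "g \<in> fst ` ?E \<union> snd ` ?E" by (metis UnI1 UnI2 fst_conv snd_conv imageI)
    qed
    then have "(\<Sum>g\<in>metric_boundary A. ?f g) \<le> (\<Sum>g\<in>fst ` ?E \<union> snd ` ?E. ?f g)"
      using E f by (intro sum_mono2) auto
    also have "\<dots> \<le> (\<Sum>g\<in>fst ` ?E. ?f g) + (\<Sum>g\<in>snd ` ?E. ?f g)"
      using sum.union_inter[of "fst ` ?E" "snd ` ?E" ?f] E f
        sum_nonneg[of "fst ` ?E \<inter> snd ` ?E" ?f] by simp
    \<comment> \<open>A point may be an end of several edges; counting it repeatedly only increases
      the sum, as \<open>f\<close> is nonnegative here.\<close>
    also have "\<dots> \<le> (\<Sum>p\<in>?E. ?f (fst p)) + (\<Sum>p\<in>?E. ?f (snd p))"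
      using add_mono[OF sum_image_le[OF E, of ?f fst] sum_image_le[OF E, of ?f snd]] f
      by (simp add: o_def)
    also have "\<dots> = (\<Sum>x\<in>A. \<Sum>y\<in>sphere x 1 - A. ?f y + ?f x)"
      using A fin by (subst sum.Sigma) (auto simp: sum.distrib split_beta)
    finally have "C * (\<Sum>g\<in>metric_boundary A. ?f g) \<le> (\<Sum>x\<in>A. \<Sum>y\<in>sphere x 1 - A. ?c y x)"
      using C by (simp add: sum_distrib_left[symmetric] mult_left_mono)
    then show ?thesis using iso[OF A] by simp
  qed
  have "0 \<le> ?c x y" for x y using C f by simp
  from demand_met[of ?c "\<lambda>_. 1", OF this zero_le_one cut]
  obtain \<psi> where \<psi>: "\<And>x y. \<psi> y x = - \<psi> x y" "\<And>x y. \<psi> x y \<le> ?c x y"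
    "\<And>x y. y \<notin> sphere x 1 \<Longrightarrow> \<psi> y x = 0" "\<And>x. (\<Sum>y\<in>sphere x 1. \<psi> y x) = 1" by blast
  show thesis
  proof (rule that)
    show "\<psi> y x = 0" if "dist x y \<noteq> 1" for x y using \<psi>(3) that by simp
  qed (fact \<psi>(1,2,4))+
qed

text \<open>A 1-chain \<open>c\<close> is read as the flow \<open>\<psi> x y = c [x, y]\<close>. Its
  differential at \<open>[x]\<close> is the inflow into \<open>x\<close>, so a chain bounding the
  constant \<open>1\<close> is a flow of unit inflow.\<close>

lemma isoperimetric_iff_unit_boundary:
  fixes e :: 'a
  assumes f: "control_function f"
  shows "(\<exists>C>0. \<forall>A :: 'a set. finite A \<longrightarrow> real (card A) \<le> C * (\<Sum>g\<in>metric_boundary A. f (dist g e)))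
    \<longleftrightarrow> (\<lambda>xs. if length xs = 1 then 1 else 0) \<in> boundaries e f 0"
    (is "?iso \<longleftrightarrow> ?unit \<in> _")
proof
  assume ?iso
  then obtain C where C: "0 < C"
    "\<And>A :: 'a set. finite A \<Longrightarrow> real (card A) \<le> C * (\<Sum>g\<in>metric_boundary A. f (dist g e))"
    by blast
  obtain \<psi> :: "'a \<Rightarrow> 'a \<Rightarrow> real" where anti: "\<And>x y. \<psi> y x = - \<psi> x y"
    and le: "\<And>x y. \<psi> x y \<le> C * (f (dist x e) + f (dist y e))"
    and supp: "\<And>x y. dist x y \<noteq> 1 \<Longrightarrow> \<psi> y x = 0" and inflow: "\<And>x. (\<Sum>y\<in>sphere x 1. \<psi> y x) = 1"
    using flow_if_isoperimetric[of f C e, OF control_function_nonneg[OF f] C] by blast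
  define c where "c xs = (if length xs = 2 then \<psi> (xs ! 0) (xs ! 1) else 0)" for xs :: "'a list"
  have "finite_propagation 1 c"
    unfolding finite_propagation_def
  proof (intro exI allI impI)
    fix xs :: "'a list" assume "length xs = Suc 1" and far: "2 \<le> dist_diagonal xs"
    then obtain x y where xs: "xs = [x, y]" by (auto simp: length_Suc_conv)
    \<comment> \<open>Comparison with the diagonal pair \<open>[x, x]\<close> shows that a pair at
      distance \<open>1\<close> lies within \<open>1\<close> of the diagonal, so propagation
      \<open>2\<close> works.\<close>
    have "dist_diagonal xs \<le> tuple_dist xs (replicate (length xs) x)"
      unfolding dist_diagonal_def
      by (intro cINF_lower bdd_belowI2[of _ 0]) (auto simp: xs tuple_dist_def lessThan_Suc le_max_iff_disj)
    also have "\<dots> = dist x y" by (simp add: xs tuple_dist_def lessThan_Suc dist_commute)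
    finally have "dist y x \<noteq> 1" using far by (simp add: dist_commute)
    then show "c xs = 0" using supp by (simp add: xs c_def)
  qed
  moreover have "controlled e f 1 c"
    unfolding controlled_def
  proof (intro exI allI impI)
    fix xs :: "'a list" assume "length xs = Suc 1"
    then obtain x y where xs: "xs = [x, y]" by (auto simp: length_Suc_conv)
    let ?m = "max (dist x e) (dist y e)"
    have "f (dist x e) \<le> f ?m" "f (dist y e) \<le> f ?m" by (auto intro: control_function_mono[OF f])
    then have "C * (f (dist x e) + f (dist y e)) \<le> C * (2 * f ?m)"
      using C(1) by (intro mult_left_mono) auto
    \<comment> \<open>Antisymmetry turns the upper bounds on \<open>\<psi> x y\<close> and
      \<open>\<psi> y x\<close> into a bound on the absolute value.\<close>
    then show "\<bar>c xs\<bar> \<le> (2 * C) * f (simplex_norm e xs)"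
      using le[of x y] le[of y x] anti[of x y]
      by (simp add: xs c_def simplex_norm_pair algebra_simps abs_le_iff)
  qed
  ultimately have "c \<in> chains e f (Suc 0)"
    using alternating_pairI[of \<psi>, OF anti] by (simp add: chains_def c_def[abs_def])
  moreover have "boundary_map (Suc 0) c = ?unit"
  proof
    fix ys :: "'a list"
    show "boundary_map (Suc 0) c ys = ?unit ys"
    proof (cases "length ys = 1")
      case True
      then obtain x where ys: "ys = [x]" by (auto simp: length_Suc_conv)
      have "(\<Sum>z | c [z, x] \<noteq> 0. c [z, x]) = (\<Sum>z\<in>sphere x 1. c [z, x])"
        using finite_subset[OF sphere_cball finite_cball] supp[of x]
        by (intro sum.mono_neutral_left) (auto simp: c_def, blast)
      then show ?thesis using inflow by (simp add: ys boundary_map_def c_def)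
    qed (simp add: boundary_map_def)
  qed
  ultimately show "?unit \<in> boundaries e f 0"
    unfolding boundaries_def by (intro image_eqI) auto
next
  assume "?unit \<in> boundaries e f 0"
  then obtain c where c: "c \<in> chains e f 1" and bd: "boundary_map 1 c = ?unit"
    by (auto simp: boundaries_def)
  define \<psi> where "\<psi> x y = c [x, y]" for x y
  have anti: "\<psi> y x = - \<psi> x y" for x y
    using c alternating_swap by (auto simp: chains_def \<psi>_def)
  obtain R where R: "\<And>xs. length xs = 2 \<Longrightarrow> dist_diagonal xs \<ge> R \<Longrightarrow> c xs = 0"
    using c unfolding chains_def finite_propagation_def numeral_2_eq_2 One_nat_def by blast
  obtain K where K: "\<And>xs. length xs = 2 \<Longrightarrow> \<bar>c xs\<bar> \<le> K * f (simplex_norm e xs)"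
    using c unfolding chains_def controlled_def numeral_2_eq_2 One_nat_def by blast
  \<comment> \<open>Large enough to contain the support of \<open>\<psi>\<close>, and positive even
    if \<open>R\<close> is not.\<close>
  define D where "D = max 1 (2 * R)"
  have supp: "dist x y \<le> D" if "\<psi> y x \<noteq> 0" for x y
    using R[of "[y, x]"] that dist_le_propagation[of "[y, x]" R x y] by (force simp: \<psi>_def D_def)
  show ?iso
  proof (rule isoperimetric_if_flow[OF f _ _ anti])
    show "0 < D" by (simp add: D_def)
    \<comment> \<open>The control condition on \<open>c\<close> does not fix the sign of
      \<open>K\<close>.\<close>
    show "0 \<le> max 0 K" by simp
    show "\<bar>\<psi> x y\<bar> \<le> max 0 K * f (max (dist x e) (dist y e))" for x y
    proof -
      have "\<bar>\<psi> x y\<bar> \<le> K * f (max (dist x e) (dist y e))"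
        using K[of "[x, y]"] by (simp add: \<psi>_def simplex_norm_pair)
      also have "\<dots> \<le> max 0 K * f (max (dist x e) (dist y e))"
        by (intro mult_right_mono control_function_nonneg[OF f]) (auto simp: le_max_iff_disj)
      finally show ?thesis .
    qed
    show "(\<Sum>y\<in>cball x D. \<psi> y x) = 1" for x
    proof -
      have "(\<Sum>y | c [y, x] \<noteq> 0. c [y, x]) = (\<Sum>y\<in>cball x D. \<psi> y x)"
        using supp finite_cball by (intro sum.mono_neutral_cong_left) (auto simp: \<psi>_def)
      then show ?thesis using fun_cong[OF bd, of "[x]"] by (simp add: boundary_map_def)
    qed
  qed
qed

end

theorem theorem4p2:
  fixes e :: "'a::metric_space" and f :: "real \<Rightarrow> real"
  assumes "uniform_discrete (UNIV :: 'a set)"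
    and "bounded_geometry (UNIV :: 'a set)"
    and "quasi_geodesic (UNIV :: 'a set)"
    and "control_function f"
  shows "(\<exists>C>0. \<forall>A :: 'a set. finite A \<longrightarrow>
            real (card A) \<le> C * (\<Sum>x\<in>metric_boundary A. f (simplex_norm e [x])))
         \<longleftrightarrow> fundamental_class e f = \<one>\<^bsub>homology_group e f 0\<^esub>"
proof -
  interpret quasi_geodesic_space "TYPE('a)"
    by standard (use assms in auto)
  show ?thesis
    unfolding fundamental_class_def homology_class_eq_one_iff[OF assms(2)] simplex_norm_singleton
    by (rule isoperimetric_iff_unit_boundary[OF assms(4)])
qed

end
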